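(* Let $m\ge 1$ be a fixed integer, and for each integer $d\ge 1$ let $\mathcal{C}_{m,d}$ be the best (i.e. largest) constant in the inequality $$\sum_{n\in\mathbb{Z}^d}|\mathcal{D}^m u(n)|^2\ \ge\ \mathcal{C}_{m,d}\sum_{n\in\mathbb{Z}^d\setminus\{0\}}\frac{|u(n)|^2}{|n|^{2m}},\qquad \forall\, u\in\mathcal{E}(\mathbb{Z}^d).$$ Then $$\lim_{d\to\infty}\frac{\mathcal{C}_{m,d}}{d^m}=2^m.$$
   Context: $\mathcal{E}(\mathbb{Z}^d)$ is the space of finitely supported functions $u:\mathbb{Z}^d\to\mathbb{R}$ with $u(0)=0$. $|n|$ is the Euclidean norm of $n\in\mathbb{Z}^d$, and $\{e_j\}_{1\le j\le d}$ is the canonical basis of $\mathbb{R}^d$. The discrete gradient is the vector $\nabla u(n)=\big(u(n)-u(n-e_j)\big)_{1\le j\le d}\in\mathbb{R}^d$ (with $|\nabla u(n)|$ its Euclidean norm), and the discrete Laplacian is $$\Delta u(n)=\sum_{j=1}^d\big[2u(n)-u(n-e_j)-u(n+e_j)\big].$$ The discrete operator $\mathcal{D}^m$ is defined by $\mathcal{D}^m u=\Delta^{m/2}u$ if $m$ is even, and $\mathcal{D}^m u=\nabla\Delta^{(m-1)/2}u$ if $m$ is odd. *)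

theory Defs
  imports "HOL-Analysis.Analysis" "HOL-Library.Function_Algebras"
begin

text \<open>
  The dimension is quantified inside the statement, so \<open>\<int>\<^sup>d\<close> is a set and not a type: its points are
  the integer sequences supported on the \<open>d\<close> coordinates \<open>0, \<dots>, d - 1\<close>.  Addition, subtraction
  and \<open>0\<close> are pointwise.
\<close>

definition lattice_pts :: "nat \<Rightarrow> (nat \<Rightarrow> int) set" where
  "lattice_pts d = {n. \<forall>i\<ge>d. n i = 0}"

definition basis_pt :: "nat \<Rightarrow> nat \<Rightarrow> int" where
  "basis_pt j = (\<lambda>i. if i = j then 1 else 0)"

definition lattice_norm :: "nat \<Rightarrow> (nat \<Rightarrow> int) \<Rightarrow> real" where
  "lattice_norm d n = L2_set (\<lambda>i. real_of_int (n i)) {..<d}"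

text \<open>Functions on \<open>\<int>\<^sup>d\<close> are represented by their extension by zero to all integer sequences.\<close>

definition test_functions :: "nat \<Rightarrow> ((nat \<Rightarrow> int) \<Rightarrow> real) set" where
  "test_functions d = {u. finite {n. u n \<noteq> 0} \<and> {n. u n \<noteq> 0} \<subseteq> lattice_pts d \<and> u 0 = 0}"

text \<open>The \<open>j\<close>-th component (\<open>j < d\<close>) of the gradient of \<open>u\<close> at \<open>n\<close>.\<close>

definition disc_grad :: "((nat \<Rightarrow> int) \<Rightarrow> real) \<Rightarrow> (nat \<Rightarrow> int) \<Rightarrow> nat \<Rightarrow> real" where
  "disc_grad u n j = u n - u (n - basis_pt j)"

definition disc_laplacian ::
    "nat \<Rightarrow> ((nat \<Rightarrow> int) \<Rightarrow> real) \<Rightarrow> (nat \<Rightarrow> int) \<Rightarrow> real" where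
  "disc_laplacian d u n = (\<Sum>j<d. 2 * u n - u (n - basis_pt j) - u (n + basis_pt j))"

text \<open>
  The operator \<open>D\<^sup>m\<close> is scalar-valued for even \<open>m\<close> and \<open>\<real>\<^sup>d\<close>-valued for odd \<open>m\<close>; only its pointwise
  Euclidean norm \<open>|D\<^sup>m u(n)|\<close> is needed.
\<close>

definition norm_D ::
    "nat \<Rightarrow> nat \<Rightarrow> ((nat \<Rightarrow> int) \<Rightarrow> real) \<Rightarrow> (nat \<Rightarrow> int) \<Rightarrow> real" where
  "norm_D d m u n =
     (if even m then \<bar>(disc_laplacian d ^^ (m div 2)) u n\<bar>
      else L2_set (disc_grad ((disc_laplacian d ^^ ((m - 1) div 2)) u) n) {..<d})"

text \<open>For \<open>u\<close> in \<open>test_functions d\<close> all but finitely many terms of both sums vanish.\<close>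

definition rellich_hardy_ineq :: "nat \<Rightarrow> nat \<Rightarrow> real \<Rightarrow> bool" where
  "rellich_hardy_ineq m d C \<longleftrightarrow>
     (\<forall>u\<in>test_functions d.
        (\<Sum>\<^sub>\<infinity>n\<in>lattice_pts d. (norm_D d m u n)\<^sup>2)
          \<ge> C * (\<Sum>\<^sub>\<infinity>n\<in>lattice_pts d - {0}. \<bar>u n\<bar>\<^sup>2 / lattice_norm d n ^ (2 * m)))"

definition best_constant :: "nat \<Rightarrow> nat \<Rightarrow> real" where
  "best_constant m d = Sup {C. rellich_hardy_ineq m d C}"

text \<open>For \<open>d \<ge> 1\<close> the supremum is attained, so it is the largest admissible constant.\<close>

lemma best_constant_greatest:
  assumes "d \<ge> 1"
  shows "rellich_hardy_ineq m d (best_constant m d)"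
    and "rellich_hardy_ineq m d C \<Longrightarrow> C \<le> best_constant m d"
proof -
  let ?S = "{C. rellich_hardy_ineq m d C}"
  define L where "L u = (\<Sum>\<^sub>\<infinity>n\<in>lattice_pts d. (norm_D d m u n)\<^sup>2)" for u
  define R where "R u = (\<Sum>\<^sub>\<infinity>n\<in>lattice_pts d - {0}. \<bar>u n\<bar>\<^sup>2 / lattice_norm d n ^ (2 * m))" for u
  have ineq: "rellich_hardy_ineq m d C \<longleftrightarrow> (\<forall>u\<in>test_functions d. C * R u \<le> L u)" for C
    by (simp add: rellich_hardy_ineq_def L_def R_def)
  have L0: "0 \<le> L u" for u
    unfolding L_def by (intro infsum_nonneg) auto
  have R0: "0 \<le> R u" for u
    unfolding R_def by (intro infsum_nonneg) (auto simp: lattice_norm_def)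
  have ne: "?S \<noteq> {}"
    using L0 by (auto simp: ineq intro!: exI[of _ 0])
  define e where "e = basis_pt 0"
  define u :: "(nat \<Rightarrow> int) \<Rightarrow> real" where "u = (\<lambda>n. if n = e then 1 else 0)"
  have e0: "e \<noteq> 0"
    by (auto simp: e_def basis_pt_def fun_eq_iff)
  have eZ: "e \<in> lattice_pts d"
    using assms by (auto simp: e_def basis_pt_def lattice_pts_def)
  have uE: "u \<in> test_functions d"
    using e0 eZ by (auto simp: test_functions_def u_def)
  have "(\<Sum>i<d. (real_of_int (e i))\<^sup>2) = (\<Sum>i<d. if i = 0 then 1 else 0)"
    by (intro sum.cong) (auto simp: e_def basis_pt_def)
  also have "\<dots> = 1"
    using assms by simp
  finally have ne1: "lattice_norm d e = 1"
    by (simp add: lattice_norm_def L2_set_def)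
  have "R u = (\<Sum>\<^sub>\<infinity>n\<in>{e}. \<bar>u n\<bar>\<^sup>2 / lattice_norm d n ^ (2 * m))"
    unfolding R_def using e0 eZ by (intro infsum_cong_neutral) (auto simp: u_def)
  also have "\<dots> = 1"
    by (simp add: u_def ne1)
  finally have Ru: "R u = 1" .
  have bdd: "bdd_above ?S"
    using uE Ru by (intro bdd_aboveI[of _ "L u"]) (force simp: ineq)
  show "rellich_hardy_ineq m d C \<Longrightarrow> C \<le> best_constant m d"
    unfolding best_constant_def by (intro cSup_upper bdd) auto
  show "rellich_hardy_ineq m d (best_constant m d)"
    unfolding ineq
  proof
    fix v assume v: "v \<in> test_functions d"
    show "best_constant m d * R v \<le> L v"
    proof (cases "R v = 0")
      case True
      then show ?thesis using L0 by simp
    next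
      case False
      then have pos: "0 < R v" using R0[of v] by linarith
      have "best_constant m d \<le> L v / R v"
        unfolding best_constant_def
        using v pos by (intro cSup_least ne) (auto simp: ineq field_simps)
      then show ?thesis using pos by (simp add: field_simps)
    qed
  qed
qed

end

theory Submission
  imports Defs
begin

text \<open>
  In high dimension the discrete Laplacian is close to its diagonal \<open>2 d\<close>, because a point has
  \<open>2 d\<close> neighbours of which only few can matter at a time.  This suggests the value \<open>(2 d)\<^sup>m\<close>.

  For the upper bound take \<open>u\<close> to be the unit mass at a basis vector \<open>e\<close>, where the weight is \<open>1\<close>.
  By symmetry of \<open>\<Delta>\<close> its energy is \<open>\<Delta>\<^sup>m u(e)\<close> (\<open>energy_eq_laplacian_power\<close>).  The diagonal of
  \<open>\<Delta>\<close> contributes \<open>(2 d)\<^sup>m\<close>, and a closed walk that leaves \<open>e\<close> loses a factor \<open>d\<close>, because its last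
  step is determined by the previous ones (\<open>laplacian_power_unit_mass\<close>).

  For the lower bound put \<open>\<rho>(n) = max 1 |n|\<^sup>2\<close>.  It is enough to have, for every weight
  \<open>\<rho>\<^sup>-\<^sup>k\<close> with \<open>k \<le> m\<close>, a Hardy inequality
  \<open>\<Sum> f \<Delta>f \<rho>\<^sup>-\<^sup>k \<ge> c \<Sum> f\<^sup>2 \<rho>\<^sup>-\<^sup>k\<^sup>-\<^sup>1\<close>
  with one constant \<open>c = (2 - \<epsilon>) d - C\<close>.  Completing the square turns the case \<open>k + 1\<close> into
  \<open>\<Sum> (\<Delta>f)\<^sup>2 \<rho>\<^sup>-\<^sup>k \<ge> c\<^sup>2 \<Sum> f\<^sup>2 \<rho>\<^sup>-\<^sup>k\<^sup>-\<^sup>2\<close>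
  (\<open>rellich_from_hardy\<close>), and these inequalities are iterated to give the factor \<open>c\<^sup>m\<close>.

  The weighted Hardy inequality follows from a positive supersolution by comparing \<open>f\<close> with it edge
  by edge (\<open>ground_state_inequality\<close>).  What is needed is \<open>\<Delta>\<phi> \<ge> c \<phi> / \<rho>\<close> for both \<open>\<phi>\<close> and
  \<open>\<rho>\<^sup>-\<^sup>k \<phi>\<close>.  The family \<open>\<phi>(n) = |n|\<^sup>-\<^sup>2\<^sup>b\<close> with \<open>\<phi>(0) = 2\<^sup>B\<close> is closed under this product, and
  each member with \<open>b \<ge> B\<close> is a supersolution with \<open>\<epsilon> = 2\<^sup>1\<^sup>-\<^sup>B\<close> (\<open>barrier_supersolution\<close>): moving
  in a direction raises the squared norm by one on average, which lowers \<open>\<phi>\<close> by a proportion of at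
  least \<open>(1 - 2\<^sup>-\<^sup>b) / |n|\<^sup>2\<close>, whereas the convexity along the axes costs an amount that does not
  grow with the number of directions.  The large exponent is what makes the constant sharp: at
  \<open>|n| = 1\<close> almost all neighbours have squared norm \<open>2\<close>, and \<open>\<phi>\<close> has to be small there.
\<close>

section \<open>Sums of finitely supported functions\<close>

definition finsupp :: "('a \<Rightarrow> real) \<Rightarrow> bool" where
  "finsupp f \<longleftrightarrow> finite {n. f n \<noteq> 0}"

lemma finsupp_summable: "finsupp f \<Longrightarrow> f summable_on UNIV"
  unfolding finsupp_def by (rule finite_nonzero_values_imp_summable_on) simp

lemma finsupp_mult [simp]: "finsupp f \<or> finsupp g \<Longrightarrow> finsupp (\<lambda>n. f n * g n)"
  unfolding finsupp_def by (erule disjE; erule rev_finite_subset) auto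

lemma finsupp_add [simp]: "finsupp f \<Longrightarrow> finsupp g \<Longrightarrow> finsupp (\<lambda>n. f n + g n)"
  unfolding finsupp_def by (rule finite_subset[of _ "{n. f n \<noteq> 0} \<union> {n. g n \<noteq> 0}"]) auto

lemma finsupp_diff [simp]: "finsupp f \<Longrightarrow> finsupp g \<Longrightarrow> finsupp (\<lambda>n. f n - g n)"
  unfolding finsupp_def by (rule finite_subset[of _ "{n. f n \<noteq> 0} \<union> {n. g n \<noteq> 0}"]) auto

lemma finsupp_abs [simp]: "finsupp f \<Longrightarrow> finsupp (\<lambda>n. \<bar>f n\<bar>)"
  by (simp add: finsupp_def)

lemma finsupp_power2 [simp]: "finsupp f \<Longrightarrow> finsupp (\<lambda>n. (f n)\<^sup>2)"
  by (simp add: finsupp_def)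

lemma finsupp_sum: "(\<And>j. j < d \<Longrightarrow> finsupp (f j)) \<Longrightarrow> finsupp (\<lambda>n. \<Sum>j<(d::nat). f j n)"
  by (induction d) (simp_all add: finsupp_def[of "\<lambda>_. 0"])

lemma finsupp_shift:
  fixes f :: "'a::ab_group_add \<Rightarrow> real"
  assumes "finsupp f" shows "finsupp (\<lambda>n. f (n + v))"
proof -
  have "{n. f (n + v) \<noteq> 0} \<subseteq> (\<lambda>n. n - v) ` {n. f n \<noteq> 0}"
    by (auto simp: image_iff) (metis add_diff_cancel_right')
  then show ?thesis
    using assms unfolding finsupp_def by (meson finite_imageI finite_subset)
qed

lemma finsupp_shift_minus:
  fixes f :: "'a::ab_group_add \<Rightarrow> real"
  assumes "finsupp f" shows "finsupp (\<lambda>n. f (n - v))"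
  using finsupp_shift[OF assms, of "- v"] by simp

lemma infsum_shift:
  fixes f :: "'a::ab_group_add \<Rightarrow> real"
  shows "(\<Sum>\<^sub>\<infinity>n. f (n + v)) = (\<Sum>\<^sub>\<infinity>n. f n)"
proof -
  have "bij_betw (\<lambda>n. n + v) UNIV UNIV"
    by (rule bij_betwI[of _ _ _ "\<lambda>n. n - v"]) auto
  then show ?thesis
    using infsum_reindex_bij_betw[of "\<lambda>n. n + v" UNIV UNIV f] by blast
qed

lemma infsum_shift_minus:
  fixes f :: "'a::ab_group_add \<Rightarrow> real"
  shows "(\<Sum>\<^sub>\<infinity>n. f (n - v)) = (\<Sum>\<^sub>\<infinity>n. f n)"
  using infsum_shift[of f "- v"] by simp

lemma infsum_add_finsupp:
  "finsupp f \<Longrightarrow> finsupp g \<Longrightarrow> (\<Sum>\<^sub>\<infinity>n. f n + g n) = (\<Sum>\<^sub>\<infinity>n. f n) + (\<Sum>\<^sub>\<infinity>n. g n)"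
  by (intro infsum_add finsupp_summable)

lemma infsum_diff_finsupp:
  "finsupp f \<Longrightarrow> finsupp g \<Longrightarrow> (\<Sum>\<^sub>\<infinity>n. f n - g n) = (\<Sum>\<^sub>\<infinity>n. f n) - (\<Sum>\<^sub>\<infinity>n. g n)"
  using infsum_add_finsupp[of f "\<lambda>n. - g n"]
  by (simp add: infsum_uminus finsupp_def)

lemma infsum_mono_finsupp:
  "finsupp f \<Longrightarrow> finsupp g \<Longrightarrow> (\<And>n. f n \<le> g n) \<Longrightarrow> (\<Sum>\<^sub>\<infinity>n. f n) \<le> (\<Sum>\<^sub>\<infinity>n. g n)"
  by (intro infsum_mono finsupp_summable)

lemma infsum_sum_finsupp:
  assumes "\<And>j. j < d \<Longrightarrow> finsupp (f j)"
  shows "(\<Sum>\<^sub>\<infinity>n. \<Sum>j<d. f j n) = (\<Sum>j<(d::nat). \<Sum>\<^sub>\<infinity>n. f j n)"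
  using assms by (induction d) (simp_all add: infsum_add_finsupp finsupp_sum)

section \<open>The Laplacian as a symmetric operator\<close>

lemma finsupp_laplacian [simp]:
  assumes "finsupp f" shows "finsupp (disc_laplacian d f)"
  unfolding disc_laplacian_def
  by (intro finsupp_sum) (simp add: assms finsupp_shift finsupp_shift_minus)

lemma finsupp_laplacian_power [simp]: "finsupp f \<Longrightarrow> finsupp ((disc_laplacian d ^^ k) f)"
  by (induction k) auto

lemma infsum_mult_laplacian:
  assumes "finsupp f"
  shows "(\<Sum>\<^sub>\<infinity>n. V n * f n * disc_laplacian d f n)
    = (\<Sum>j<d. \<Sum>\<^sub>\<infinity>n. V n * f n * (2 * f n - f (n - basis_pt j) - f (n + basis_pt j)))"
proof -
  have "finsupp (\<lambda>n. V n * f n * (2 * f n - f (n - v) - f (n + v)))" for v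
    using assms finsupp_shift[OF assms] finsupp_shift_minus[OF assms] by simp
  from infsum_sum_finsupp[of d, OF this] show ?thesis
    unfolding disc_laplacian_def sum_distrib_left by blast
qed

lemma laplacian_symmetric:
  assumes f: "finsupp f" and g: "finsupp g"
  shows "(\<Sum>\<^sub>\<infinity>n. f n * disc_laplacian d g n) = (\<Sum>\<^sub>\<infinity>n. g n * disc_laplacian d f n)"
proof -
  note fs = f g finsupp_shift[OF f] finsupp_shift_minus[OF f] finsupp_shift[OF g] finsupp_shift_minus[OF g]
  have one: "(\<Sum>\<^sub>\<infinity>n. f n * (2 * g n - g (n - v) - g (n + v)))
      = (\<Sum>\<^sub>\<infinity>n. g n * (2 * f n - f (n - v) - f (n + v)))" for v
  proof -
    have "(\<Sum>\<^sub>\<infinity>n. f n * (2 * g n - g (n - v) - g (n + v)))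
        = (\<Sum>\<^sub>\<infinity>n. 2 * f n * g n - f n * g (n - v) - f n * g (n + v))"
      by (intro infsum_cong) (simp add: algebra_simps)
    also have "\<dots> = (\<Sum>\<^sub>\<infinity>n. 2 * f n * g n) - (\<Sum>\<^sub>\<infinity>n. f n * g (n - v)) - (\<Sum>\<^sub>\<infinity>n. f n * g (n + v))"
      by (simp add: infsum_diff_finsupp fs)
    also have "(\<Sum>\<^sub>\<infinity>n. f n * g (n - v)) = (\<Sum>\<^sub>\<infinity>n. f (n + v) * g n)"
      using infsum_shift[of "\<lambda>n. f n * g (n - v)" v] by simp
    also have "(\<Sum>\<^sub>\<infinity>n. f n * g (n + v)) = (\<Sum>\<^sub>\<infinity>n. f (n - v) * g n)"
      using infsum_shift_minus[of "\<lambda>n. f n * g (n + v)" v] by simp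
    also have "(\<Sum>\<^sub>\<infinity>n. 2 * f n * g n) - (\<Sum>\<^sub>\<infinity>n. f (n + v) * g n) - (\<Sum>\<^sub>\<infinity>n. f (n - v) * g n)
        = (\<Sum>\<^sub>\<infinity>n. 2 * f n * g n - f (n + v) * g n - f (n - v) * g n)"
      by (simp add: infsum_diff_finsupp fs)
    also have "\<dots> = (\<Sum>\<^sub>\<infinity>n. g n * (2 * f n - f (n - v) - f (n + v)))"
      by (intro infsum_cong) (simp add: algebra_simps)
    finally show ?thesis .
  qed
  have fin: "finsupp (\<lambda>n. f n * (2 * g n - g (n - v) - g (n + v)))"
    "finsupp (\<lambda>n. g n * (2 * f n - f (n - v) - f (n + v)))" for v
    by (simp_all add: fs)
  show ?thesis
    unfolding disc_laplacian_def sum_distrib_left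
    using one by (simp add: infsum_sum_finsupp fin)
qed

lemma infsum_grad_sq:
  assumes f: "finsupp f"
  shows "(\<Sum>\<^sub>\<infinity>n. (L2_set (disc_grad f n) {..<d})\<^sup>2) = (\<Sum>\<^sub>\<infinity>n. f n * disc_laplacian d f n)"
proof -
  note fs = f finsupp_shift[OF f] finsupp_shift_minus[OF f]
  have one: "(\<Sum>\<^sub>\<infinity>n. (f n - f (n - v))\<^sup>2) = (\<Sum>\<^sub>\<infinity>n. f n * (2 * f n - f (n - v) - f (n + v)))" for v
  proof -
    have "(\<Sum>\<^sub>\<infinity>n. (f n - f (n - v))\<^sup>2)
        = (\<Sum>\<^sub>\<infinity>n. f n * (f n - f (n - v)) + f (n - v) * (f (n - v) - f n))"
      by (intro infsum_cong) (simp add: algebra_simps power2_eq_square)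
    also have "\<dots> = (\<Sum>\<^sub>\<infinity>n. f n * (f n - f (n - v))) + (\<Sum>\<^sub>\<infinity>n. f (n - v) * (f (n - v) - f n))"
      by (simp add: infsum_add_finsupp fs)
    also have "(\<Sum>\<^sub>\<infinity>n. f (n - v) * (f (n - v) - f n)) = (\<Sum>\<^sub>\<infinity>n. f n * (f n - f (n + v)))"
      using infsum_shift[of "\<lambda>n. f (n - v) * (f (n - v) - f n)" v] by simp
    also have "(\<Sum>\<^sub>\<infinity>n. f n * (f n - f (n - v))) + (\<Sum>\<^sub>\<infinity>n. f n * (f n - f (n + v)))
        = (\<Sum>\<^sub>\<infinity>n. f n * (f n - f (n - v)) + f n * (f n - f (n + v)))"
      by (simp add: infsum_add_finsupp fs)
    also have "\<dots> = (\<Sum>\<^sub>\<infinity>n. f n * (2 * f n - f (n - v) - f (n + v)))"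
      by (intro infsum_cong) (simp add: algebra_simps)
    finally show ?thesis .
  qed
  have fin: "finsupp (\<lambda>n. (f n - f (n - v))\<^sup>2)" for v
    by (simp_all add: fs)
  have "(\<Sum>\<^sub>\<infinity>n. (L2_set (disc_grad f n) {..<d})\<^sup>2)
      = (\<Sum>\<^sub>\<infinity>n. \<Sum>j<d. (f n - f (n - basis_pt j))\<^sup>2)"
    by (simp add: L2_set_def disc_grad_def sum_nonneg)
  also have "\<dots> = (\<Sum>\<^sub>\<infinity>n. f n * disc_laplacian d f n)"
    using infsum_mult_laplacian[OF f, of "\<lambda>_. 1" d] by (simp add: infsum_sum_finsupp fin one)
  finally show ?thesis .
qed

lemma laplacian_power_symmetric:
  assumes f: "finsupp f" and g: "finsupp g"
  shows "(\<Sum>\<^sub>\<infinity>n. (disc_laplacian d ^^ k) f n * g n) = (\<Sum>\<^sub>\<infinity>n. f n * (disc_laplacian d ^^ k) g n)"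
  using g
proof (induction k arbitrary: g)
  case (Suc k)
  have "(\<Sum>\<^sub>\<infinity>n. (disc_laplacian d ^^ Suc k) f n * g n)
      = (\<Sum>\<^sub>\<infinity>n. g n * disc_laplacian d ((disc_laplacian d ^^ k) f) n)"
    by (simp add: mult.commute)
  also have "\<dots> = (\<Sum>\<^sub>\<infinity>n. (disc_laplacian d ^^ k) f n * disc_laplacian d g n)"
    using f Suc.prems by (intro laplacian_symmetric) auto
  also have "\<dots> = (\<Sum>\<^sub>\<infinity>n. f n * (disc_laplacian d ^^ k) (disc_laplacian d g) n)"
    using Suc.prems by (intro Suc.IH) auto
  finally show ?case
    by (simp add: funpow_swap1)
qed simp

text \<open>
  For either parity of \<open>m\<close>, moving half of the differences from one factor to the other turns the
  energy into the quadratic form of \<open>\<Delta>\<^sup>m\<close>.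
\<close>

lemma energy_eq_laplacian_power:
  assumes u: "finsupp u"
  shows "(\<Sum>\<^sub>\<infinity>n. (norm_D d m u n)\<^sup>2) = (\<Sum>\<^sub>\<infinity>n. u n * (disc_laplacian d ^^ m) u n)"
proof -
  let ?L = "\<lambda>k. (disc_laplacian d ^^ k) u"
  have eq: "(\<Sum>\<^sub>\<infinity>n. ?L k n * ?L l n) = (\<Sum>\<^sub>\<infinity>n. u n * ?L (k + l) n)" for k l
    using u by (subst laplacian_power_symmetric) (auto simp: funpow_add)
  show ?thesis
  proof (cases "even m")
    case True
    then obtain k where k: "m = k + k" by (auto elim!: evenE simp: mult_2)
    then have "m div 2 = k" by simp
    then show ?thesis
      using eq[of k k] True by (simp add: norm_D_def power2_eq_square k)
  next
    case False
    then obtain k where k: "m = k + Suc k" by (auto elim!: oddE simp: mult_2)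
    then have "(m - 1) div 2 = k" by simp
    moreover have "finsupp (?L k)" using u by auto
    ultimately have "(\<Sum>\<^sub>\<infinity>n. (norm_D d m u n)\<^sup>2) = (\<Sum>\<^sub>\<infinity>n. ?L k n * ?L (Suc k) n)"
      using infsum_grad_sq[of "?L k" d] False by (simp add: norm_D_def)
    then show ?thesis
      using eq[of k "Suc k"] by (simp add: k)
  qed
qed

section \<open>A ground state inequality for a weighted form\<close>

text \<open>
  For a positive comparison function \<open>\<phi>\<close>, each edge contributes a product \<open>f(n) f(n + v)\<close> that is
  at most \<open>(f(n)\<^sup>2 \<phi>(n + v) / \<phi>(n) + f(n + v)\<^sup>2 \<phi>(n) / \<phi>(n + v)) / 2\<close>.  The weight \<open>V\<close> of the form
  is not symmetric in the two ends of the edge, so its mean over the two ends appears, and this is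
  why the lower bound involves the Laplacians of both \<open>\<phi>\<close> and \<open>V \<phi>\<close>.
\<close>

lemma ground_state_inequality:
  assumes f: "finsupp f" and phi: "\<And>n. \<phi> n > 0" and V: "\<And>n. V n \<ge> 0"
  shows "(\<Sum>\<^sub>\<infinity>n. ((V n * disc_laplacian d \<phi> n + disc_laplacian d (\<lambda>n. V n * \<phi> n) n) / (2 * \<phi> n)) * (f n)\<^sup>2)
    \<le> (\<Sum>\<^sub>\<infinity>n. V n * f n * disc_laplacian d f n)"
proof -
  define E where "E v n = ((V n * (2 * \<phi> n - \<phi> (n - v) - \<phi> (n + v))
      + (2 * (V n * \<phi> n) - V (n - v) * \<phi> (n - v) - V (n + v) * \<phi> (n + v))) / (2 * \<phi> n)) * (f n)\<^sup>2" for v n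
  note fs = f finsupp_shift[OF f] finsupp_shift_minus[OF f]
  have finE: "finsupp (E v)" for v
    unfolding E_def by (intro finsupp_mult disjI2 finsupp_power2 f)
  have one: "(\<Sum>\<^sub>\<infinity>n. E v n) \<le> (\<Sum>\<^sub>\<infinity>n. V n * f n * (2 * f n - f (n - v) - f (n + v)))" for v
  proof -
    define a where "a n = (V n + V (n + v)) / 2" for n
    define p where "p n = a n * (\<phi> (n + v) / \<phi> n) * (f n)\<^sup>2" for n
    define q where "q n = a (n - v) * (\<phi> (n - v) / \<phi> n) * (f n)\<^sup>2" for n
    define x where "x n = V n * f n * f (n + v)" for n
    define y where "y n = V n * f n * f (n - v)" for n
    define z where "z n = 2 * V n * (f n)\<^sup>2" for n
    have fin: "finsupp p" "finsupp q" "finsupp x" "finsupp y" "finsupp z"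
      unfolding p_def q_def x_def y_def z_def
      by (intro finsupp_mult disjI2 finsupp_power2 fs)+
    have edge: "x n + y (n + v) \<le> p n + q (n + v)" for n
    proof -
      have amgm: "2 * s * t \<le> (k / l) * s\<^sup>2 + (l / k) * t\<^sup>2" if "k > 0" "l > 0" for s t k l :: real
      proof -
        have "0 \<le> (k * s - l * t)\<^sup>2 / (k * l)" using that by simp
        also have "\<dots> = (k / l) * s\<^sup>2 + (l / k) * t\<^sup>2 - 2 * s * t"
          using that by (simp add: field_simps power2_eq_square)
        finally show ?thesis by simp
      qed
      have "x n + y (n + v) = a n * (2 * f n * f (n + v))"
        by (simp add: x_def y_def a_def field_simps)
      also have "\<dots> \<le> a n * ((\<phi> (n + v) / \<phi> n) * (f n)\<^sup>2 + (\<phi> n / \<phi> (n + v)) * (f (n + v))\<^sup>2)"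
        using V[of n] V[of "n + v"] by (intro mult_left_mono amgm phi) (simp add: a_def)
      also have "\<dots> = p n + q (n + v)"
        by (simp add: p_def q_def distrib_left mult.assoc)
      finally show ?thesis .
    qed
    have shift: "(\<Sum>\<^sub>\<infinity>n. y (n + v)) = (\<Sum>\<^sub>\<infinity>n. y n)" "(\<Sum>\<^sub>\<infinity>n. q (n + v)) = (\<Sum>\<^sub>\<infinity>n. q n)"
      by (rule infsum_shift)+
    have "(\<Sum>\<^sub>\<infinity>n. x n + y (n + v)) \<le> (\<Sum>\<^sub>\<infinity>n. p n + q (n + v))"
      by (intro infsum_mono_finsupp edge) (simp_all add: fin finsupp_shift)
    then have le: "(\<Sum>\<^sub>\<infinity>n. x n) + (\<Sum>\<^sub>\<infinity>n. y n) \<le> (\<Sum>\<^sub>\<infinity>n. p n) + (\<Sum>\<^sub>\<infinity>n. q n)"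
      by (simp add: infsum_add_finsupp fin finsupp_shift shift)
    have "(\<Sum>\<^sub>\<infinity>n. E v n) = (\<Sum>\<^sub>\<infinity>n. z n - p n - q n)"
    proof (intro infsum_cong)
      fix n
      show "E v n = z n - p n - q n"
        using phi[of n] by (simp add: E_def z_def p_def q_def a_def field_simps)
    qed
    also have "\<dots> \<le> (\<Sum>\<^sub>\<infinity>n. z n - y n - x n)"
      using le by (simp add: infsum_diff_finsupp fin)
    also have "\<dots> = (\<Sum>\<^sub>\<infinity>n. V n * f n * (2 * f n - f (n - v) - f (n + v)))"
      by (intro infsum_cong) (simp add: x_def y_def z_def algebra_simps power2_eq_square)
    finally show ?thesis .
  qed
  have "(\<Sum>\<^sub>\<infinity>n. ((V n * disc_laplacian d \<phi> n + disc_laplacian d (\<lambda>n. V n * \<phi> n) n) / (2 * \<phi> n)) * (f n)\<^sup>2)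
      = (\<Sum>\<^sub>\<infinity>n. \<Sum>j<d. E (basis_pt j) n)"
    unfolding E_def disc_laplacian_def
    by (simp only: sum_distrib_left sum_distrib_right sum_divide_distrib flip: sum.distrib)
  also have "\<dots> = (\<Sum>j<d. \<Sum>\<^sub>\<infinity>n. E (basis_pt j) n)"
    by (intro infsum_sum_finsupp finE)
  also have "\<dots> \<le> (\<Sum>\<^sub>\<infinity>n. V n * f n * disc_laplacian d f n)"
    unfolding infsum_mult_laplacian[OF f] by (intro sum_mono one)
  finally show ?thesis .
qed

section \<open>Negative powers of the norm as supersolutions\<close>

text \<open>
  Second-order comparison of \<open>x \<mapsto> x\<^sup>-\<^sup>b\<close> at \<open>s \<plusminus> h\<close> with its value at the midpoint, in the scaled
  variables \<open>p = s / (s + h)\<close>, \<open>q = s / (s - h)\<close>, \<open>x = h / s\<close>.  The bound on \<open>p\<close> and \<open>q\<close> keeps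
  away from the singularity; the value 8 is what the lattice points below provide.
\<close>

lemma power_sum_second_order:
  "\<exists>C\<ge>0. \<forall>p q x :: real. 0 < p \<and> p \<le> 8 \<and> 0 < q \<and> q \<le> 8 \<and> p * (1 + x) = 1 \<and> q * (1 - x) = 1
     \<longrightarrow> p ^ b + q ^ b \<le> 2 + C * x\<^sup>2"
proof (induction b)
  case 0
  then show ?case by auto
next
  case (Suc b)
  then obtain C where C: "C \<ge> 0" and IH: "\<And>p q x :: real. 0 < p \<Longrightarrow> p \<le> 8 \<Longrightarrow> 0 < q \<Longrightarrow> q \<le> 8
      \<Longrightarrow> p * (1 + x) = 1 \<Longrightarrow> q * (1 - x) = 1 \<Longrightarrow> p ^ b + q ^ b \<le> 2 + C * x\<^sup>2"
    by blast
  have lip: "\<bar>q ^ k - p ^ k\<bar> \<le> real k * 8 ^ k * \<bar>q - p\<bar>"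
    if "0 < p" "p \<le> 8" "0 < q" "q \<le> 8" for p q :: real and k
  proof (induction k)
    case (Suc k)
    have "\<bar>q ^ Suc k - p ^ Suc k\<bar> = \<bar>q * (q ^ k - p ^ k) + p ^ k * (q - p)\<bar>"
      by (simp add: algebra_simps)
    also have "\<dots> \<le> q * \<bar>q ^ k - p ^ k\<bar> + p ^ k * \<bar>q - p\<bar>"
      using that by (intro order_trans[OF abs_triangle_ineq]) (simp add: abs_mult)
    also have "\<dots> \<le> 8 * (real k * 8 ^ k * \<bar>q - p\<bar>) + 8 ^ Suc k * \<bar>q - p\<bar>"
    proof (intro add_mono mult_mono Suc.IH)
      have "p ^ k \<le> 8 ^ k" using that by (intro power_mono) auto
      then show "p ^ k \<le> 8 ^ Suc k" by (simp add: order_trans[OF _ mult_right_mono[of 1 8]])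
    qed (use that in auto)
    finally show ?case by (simp add: algebra_simps)
  qed simp
  define M where "M = real (Suc b) * 8 ^ Suc b"
  have "p ^ Suc b + q ^ Suc b \<le> 2 + (C + 16 * M) * x\<^sup>2"
    if pq: "0 < p" "p \<le> 8" "0 < q" "q \<le> 8" "p * (1 + x) = 1" "q * (1 - x) = 1" for p q x :: real
  proof -
    have p: "p = 1 - x * p" and q: "q = 1 + x * q"
      using pq(5,6) by (simp_all add: algebra_simps)
    have "p ^ Suc b + q ^ Suc b = p ^ b * p + q ^ b * q"
      by simp
    also have "\<dots> = p ^ b * (1 - x * p) + q ^ b * (1 + x * q)"
      by (simp only: p[symmetric] q[symmetric])
    also have "\<dots> = p ^ b + q ^ b + x * (q ^ Suc b - p ^ Suc b)"
      by (simp add: algebra_simps)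
    also have "x * (q ^ Suc b - p ^ Suc b) \<le> \<bar>x\<bar> * (M * \<bar>q - p\<bar>)"
      using lip[OF pq(1-4), of "Suc b"] unfolding M_def
      by - (rule order_trans[OF abs_ge_self], simp only: abs_mult mult_left_mono abs_ge_zero)
    also have "q - p = x * (p + q)"
      using pq(5,6) by algebra
    also have "\<bar>x\<bar> * (M * \<bar>x * (p + q)\<bar>) = M * x\<^sup>2 * (p + q)"
    proof -
      have "x\<^sup>2 = \<bar>x\<bar> * \<bar>x\<bar>" by (simp add: power2_eq_square)
      moreover have "\<bar>p + q\<bar> = p + q" using pq by simp
      ultimately show ?thesis by (simp only: abs_mult mult_ac)
    qed
    also have "\<dots> \<le> M * x\<^sup>2 * 16"
      using pq by (intro mult_left_mono) (auto simp: M_def)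
    finally show ?thesis
      using IH[OF pq] by (simp add: algebra_simps)
  qed
  then show ?case
    using C by (intro exI[of _ "C + 16 * M"]) (auto simp: M_def)
qed

text \<open>
  As a function of the squared norm \<open>r\<close>.  The value at the origin enters the supersolution property
  at \<open>0\<close>, where it has to exceed the values \<open>1\<close> at the neighbours by the factor \<open>2\<^sup>B\<close>, and at the
  \<open>2 d\<close> neighbours, where it is only one of \<open>2 d\<close> terms.
\<close>

definition barrier :: "nat \<Rightarrow> nat \<Rightarrow> int \<Rightarrow> real" where
  "barrier B b r = (if r = 0 then 2 ^ B else 1 / of_int r ^ b)"

text \<open>
  The sum of the two neighbours along an axis with coordinate \<open>t\<close>: if neither is the origin, the
  first-order terms in \<open>t\<close> cancel.  The origin occurs only for \<open>r = t\<^sup>2 = 1\<close>, and there the error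
  term is as large as its constant.
\<close>

lemma barrier_pair:
  "\<exists>C\<ge>0. \<forall>r t :: int. r \<ge> 1 \<and> t\<^sup>2 \<le> r \<longrightarrow>
     barrier B b (r + 1 - 2 * t) + barrier B b (r + 1 + 2 * t)
       \<le> 2 / of_int (r + 1) ^ b + C * of_int (t\<^sup>2) / of_int r ^ (b + 2)"
proof -
  obtain C where C: "C \<ge> 0" and key: "\<And>p q x :: real. 0 < p \<Longrightarrow> p \<le> 8 \<Longrightarrow> 0 < q \<Longrightarrow> q \<le> 8
      \<Longrightarrow> p * (1 + x) = 1 \<Longrightarrow> q * (1 - x) = 1 \<Longrightarrow> p ^ b + q ^ b \<le> 2 + C * x\<^sup>2"
    using power_sum_second_order[of b] by blast
  define K where "K = 4 * C + 2 ^ B + 1"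
  have "barrier B b (r + 1 - 2 * t) + barrier B b (r + 1 + 2 * t)
       \<le> 2 / of_int (r + 1) ^ b + K * of_int (t\<^sup>2) / of_int r ^ (b + 2)"
    if r: "r \<ge> 1" "t\<^sup>2 \<le> r" for r t :: int
  proof (cases "r + 1 - 2 * \<bar>t\<bar> = 0")
    case True
    \<comment> \<open>One of the two neighbours is the origin.\<close>
    then have "(\<bar>t\<bar> - 1)\<^sup>2 \<le> 0"
      using r by (simp add: power2_eq_square algebra_simps)
    then have t: "\<bar>t\<bar> = 1" by simp
    then have r1: "r = 1" using True by simp
    have "(1::real) / 4 ^ b \<le> 1" by simp
    then have "2 ^ B + 1 / 4 ^ b \<le> 2 / 2 ^ b + K"
      using C by (simp add: K_def add_increasing)
    moreover have "t = 1 \<or> t = -1" using t by linarith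
    ultimately show ?thesis
      using r1 by (auto simp: barrier_def)
  next
    case False
    have sq: "t\<^sup>2 = \<bar>t\<bar>\<^sup>2" by simp
    have "0 \<le> (\<bar>t\<bar> - 1)\<^sup>2" by simp
    then have ge: "r + 1 - 2 * \<bar>t\<bar> \<ge> 0"
      using r(2) by (simp add: power2_eq_square algebra_simps)
    then have pos: "r + 1 - 2 * \<bar>t\<bar> \<ge> 1" using False by linarith
    \<comment> \<open>The nearer neighbour is still at a squared distance comparable to \<open>r\<close> from the origin.\<close>
    have "4 * (r + 1 - 2 * \<bar>t\<bar>) \<ge> r"
    proof (cases "\<bar>t\<bar> \<le> 2")
      case True
      have "3 * (2 * \<bar>t\<bar>) \<le> 3 * r" using pos by (intro mult_left_mono) auto
      with True show ?thesis by (simp add: algebra_simps)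
    next
      case False
      then have "0 \<le> (3 * \<bar>t\<bar> - 2) * (\<bar>t\<bar> - 2)" by (intro mult_nonneg_nonneg) auto
      then show ?thesis
        using r(2) by (simp add: power2_eq_square algebra_simps)
    qed
    then have far: "8 * (r + 1 - 2 * \<bar>t\<bar>) \<ge> r + 1"
      using r by linarith
    define s h u w where "s = real_of_int (r + 1)" and "h = 2 * real_of_int t"
      and "u = s + h" and "w = s - h"
    have int: "real_of_int (r + 1 + 2 * t) = u" "real_of_int (r + 1 - 2 * t) = w"
      by (simp_all add: s_def h_def u_def w_def)
    have s: "s > 0" "real_of_int r \<le> s" using r by (simp_all add: s_def)
    have both: "r + 1 - 2 * \<bar>t\<bar> \<le> r + 1 + 2 * t" "r + 1 - 2 * \<bar>t\<bar> \<le> r + 1 - 2 * t"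
      by simp_all
    have "r + 1 + 2 * t \<ge> 1" "r + 1 - 2 * t \<ge> 1"
      using both pos by (metis order_trans)+
    moreover have "8 * (r + 1 + 2 * t) \<ge> r + 1" "8 * (r + 1 - 2 * t) \<ge> r + 1"
      using both[THEN mult_left_mono, of 8] far by simp_all
    ultimately have uw: "u \<ge> 1" "w \<ge> 1" "8 * u \<ge> s" "8 * w \<ge> s"
      unfolding int[symmetric] s_def by linarith+
    have "(s / u) ^ b + (s / w) ^ b \<le> 2 + C * (h / s)\<^sup>2"
    proof (rule key)
      have "1 + h / s = u / s" "1 - h / s = w / s"
        using s by (simp_all add: u_def w_def add_divide_distrib diff_divide_distrib)
      then show "s / u * (1 + h / s) = 1" "s / w * (1 - h / s) = 1"
        using s uw by simp_all
    qed (use s uw in \<open>auto simp: field_simps\<close>)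
    then have "((s / u) ^ b + (s / w) ^ b) / s ^ b \<le> (2 + C * (h / s)\<^sup>2) / s ^ b"
      using s by (intro divide_right_mono) auto
    moreover have "((s / u) ^ b + (s / w) ^ b) / s ^ b = 1 / w ^ b + 1 / u ^ b"
      using s by (simp add: power_divide add_divide_distrib)
    moreover have "(2 + C * (h / s)\<^sup>2) / s ^ b = 2 / s ^ b + C * h\<^sup>2 / s ^ (b + 2)"
      using s by (simp add: power_divide add_divide_distrib power_add power2_eq_square mult.commute)
    moreover have "C * h\<^sup>2 / s ^ (b + 2) \<le> C * h\<^sup>2 / real_of_int r ^ (b + 2)"
      using s r C by (intro divide_left_mono power_mono) auto
    moreover have "C * h\<^sup>2 / real_of_int r ^ (b + 2) \<le> K * of_int (t\<^sup>2) / real_of_int r ^ (b + 2)"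
      using r C by (intro divide_right_mono) (auto simp: K_def h_def algebra_simps)
    moreover have "barrier B b (r + 1 - 2 * t) + barrier B b (r + 1 + 2 * t) = 1 / w ^ b + 1 / u ^ b"
      using uw int by (auto simp: barrier_def)
    ultimately show ?thesis
      by (simp add: s_def)
  qed
  then show ?thesis
    using C by (intro exI[of _ K]) (auto simp: K_def)
qed

text \<open>Convexity of \<open>s \<mapsto> (1 + s)\<^sup>-\<^sup>b\<close> on the unit interval: the graph lies below its chord.\<close>

lemma inverse_power_below_chord:
  fixes s :: real
  assumes "0 \<le> s" "s \<le> 1"
  shows "1 / (1 + s) ^ b \<le> 1 - s * (1 - 1 / 2 ^ b)"
proof (induction b)
  case (Suc b)
  define q :: real where "q = 1 / 2 ^ b"
  have q: "0 \<le> q" "q \<le> 1" by (simp_all add: q_def)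
  have "1 / (1 + s) ^ Suc b = 1 / (1 + s) ^ b / (1 + s)"
    by simp
  also have "\<dots> \<le> (1 - s * (1 - q)) / (1 + s)"
    using Suc.IH assms by (intro divide_right_mono) (auto simp: q_def)
  also have "\<dots> \<le> 1 - s * (1 - q / 2)"
  proof -
    have "0 \<le> s * (1 - s) * (1 - q / 2)"
      using assms q by (intro mult_nonneg_nonneg) auto
    also have "s * (1 - s) * (1 - q / 2) = (1 - s * (1 - q / 2)) * (1 + s) - (1 - s * (1 - q))"
      by (simp add: field_simps)
    finally have "1 - s * (1 - q) \<le> (1 - s * (1 - q / 2)) * (1 + s)"
      by (simp only: diff_ge_0_iff_ge)
    then show ?thesis using assms by (simp add: divide_le_eq)
  qed
  finally show ?case by (simp add: q_def mult.commute)
qed simp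

definition norm_sq :: "nat \<Rightarrow> (nat \<Rightarrow> int) \<Rightarrow> int" where
  "norm_sq d n = (\<Sum>i<d. (n i)\<^sup>2)"

text \<open>
  The truncation gives the origin the weight of its neighbours.  The iterates \<open>\<Delta>\<^sup>k u\<close> need not vanish
  at the origin even if \<open>u\<close> does, so inequalities that are to be iterated have to control their
  value there.
\<close>

definition pos_norm_sq :: "nat \<Rightarrow> (nat \<Rightarrow> int) \<Rightarrow> real" where
  "pos_norm_sq d n = max 1 (of_int (norm_sq d n))"

lemma pos_norm_sq_pos [simp]: "pos_norm_sq d n > 0"
  by (simp add: pos_norm_sq_def)

lemma norm_sq_nonneg: "norm_sq d n \<ge> 0"
  by (simp add: norm_sq_def sum_nonneg)

lemma barrier_norm_sq_pos: "barrier B b (norm_sq d n) > 0"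
  using norm_sq_nonneg[of d n] by (auto simp: barrier_def)

lemma norm_sq_neighbour:
  assumes "j < d"
  shows "norm_sq d (n + basis_pt j) = norm_sq d n + 1 + 2 * n j"
    and "norm_sq d (n - basis_pt j) = norm_sq d n + 1 - 2 * n j"
proof -
  have "(\<Sum>i<d. ((n + basis_pt j) i)\<^sup>2) = (\<Sum>i<d. (n i)\<^sup>2 + (if i = j then 1 + 2 * n j else 0))"
    by (intro sum.cong) (auto simp: basis_pt_def power2_eq_square algebra_simps)
  then show "norm_sq d (n + basis_pt j) = norm_sq d n + 1 + 2 * n j"
    using assms by (simp add: norm_sq_def sum.distrib)
  have "(\<Sum>i<d. ((n - basis_pt j) i)\<^sup>2) = (\<Sum>i<d. (n i)\<^sup>2 + (if i = j then 1 - 2 * n j else 0))"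
    by (intro sum.cong) (auto simp: basis_pt_def power2_eq_square algebra_simps)
  then show "norm_sq d (n - basis_pt j) = norm_sq d n + 1 - 2 * n j"
    using assms by (simp add: norm_sq_def sum.distrib)
qed

text \<open>
  The decisive point is that the error \<open>C\<close> does not depend on the dimension: a step in direction
  \<open>j\<close> costs a second-order term proportional to \<open>n\<^sub>j\<^sup>2\<close>, and these add up to \<open>|n|\<^sup>2\<close>.  The main part
  comes from the increase of the squared norm by one in each of the \<open>2 d\<close> directions.
\<close>

lemma barrier_supersolution:
  assumes "B \<le> b"
  shows "\<exists>C\<ge>0. \<forall>d n. (2 * real d * (1 - 1 / 2 ^ B) - C) * (barrier B b (norm_sq d n) / pos_norm_sq d n)
     \<le> disc_laplacian d (\<lambda>n. barrier B b (norm_sq d n)) n"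
proof -
  obtain C where C: "C \<ge> 0" and pair: "\<And>r t :: int. r \<ge> 1 \<Longrightarrow> t\<^sup>2 \<le> r \<Longrightarrow>
     barrier B b (r + 1 - 2 * t) + barrier B b (r + 1 + 2 * t)
       \<le> 2 / of_int (r + 1) ^ b + C * of_int (t\<^sup>2) / of_int r ^ (b + 2)"
    using barrier_pair[of B b] by blast
  have "(2 * real d * (1 - 1 / 2 ^ B) - C) * (barrier B b (norm_sq d n) / pos_norm_sq d n)
     \<le> disc_laplacian d (\<lambda>n. barrier B b (norm_sq d n)) n" for d n
  proof -
    define r where "r = norm_sq d n"
    have lap: "disc_laplacian d (\<lambda>n. barrier B b (norm_sq d n)) n
      = (\<Sum>j<d. 2 * barrier B b r - (barrier B b (r + 1 - 2 * n j) + barrier B b (r + 1 + 2 * n j)))"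
      unfolding disc_laplacian_def by (intro sum.cong) (auto simp: norm_sq_neighbour r_def)
    have coord: "(n j)\<^sup>2 \<le> r" if "j < d" for j
      unfolding r_def norm_sq_def using that by (intro member_le_sum) auto
    show ?thesis
    proof (cases "r = 0")
      case True
      then have "n j = 0" if "j < d" for j
        using coord[OF that] by simp
      then have "disc_laplacian d (\<lambda>n. barrier B b (norm_sq d n)) n = (\<Sum>j<d. 2 * 2 ^ B - 2)"
        unfolding lap using True by (intro sum.cong) (auto simp: barrier_def)
      also have "\<dots> = 2 * real d * (1 - 1 / 2 ^ B) * 2 ^ B"
        by (simp add: field_simps)
      finally show ?thesis
        using True C by (simp add: barrier_def pos_norm_sq_def r_def left_diff_distrib)
    next
      case False
      then have r: "r \<ge> 1" using norm_sq_nonneg[of d n] by (simp add: r_def)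
      define R where "R = real_of_int r"
      have R: "R \<ge> 1" using r by (simp add: R_def)
      have sumR: "(\<Sum>j<d. real_of_int ((n j)\<^sup>2)) = R"
        by (simp add: R_def r_def norm_sq_def)
      have sumC: "(\<Sum>j<d. C * real_of_int ((n j)\<^sup>2) / R ^ (b + 2)) = C / R ^ (b + 1)"
      proof -
        have "(\<Sum>j<d. C * real_of_int ((n j)\<^sup>2) / R ^ (b + 2)) = C * R / R ^ (b + 2)"
          using sumR by (simp only: flip: sum_divide_distrib sum_distrib_left)
        then show ?thesis using R by simp
      qed
      have drop: "(1 - 1 / 2 ^ B) / R ^ (b + 1) \<le> 1 / R ^ b - 1 / (R + 1) ^ b"
      proof -
        have "1 / 2 ^ b \<le> (1::real) / 2 ^ B"
          using assms by (intro divide_left_mono power_increasing) auto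
        then have "(1 - 1 / 2 ^ B) / R \<le> (1 - 1 / 2 ^ b) / R"
          using R by (intro divide_right_mono) auto
        also have "\<dots> \<le> 1 - 1 / (1 + 1 / R) ^ b"
          using inverse_power_below_chord[of "1 / R" b] R by simp
        finally have "(1 - 1 / 2 ^ B) / R / R ^ b \<le> (1 - 1 / (1 + 1 / R) ^ b) / R ^ b"
          using R by (intro divide_right_mono) auto
        moreover have "(1 + 1 / R) ^ b * R ^ b = (R + 1) ^ b"
          using R by (simp add: field_simps flip: power_mult_distrib)
        ultimately show ?thesis
          by (simp add: diff_divide_distrib)
      qed
      have "(2 * real d * (1 - 1 / 2 ^ B) - C) * (barrier B b (norm_sq d n) / pos_norm_sq d n)
          = 2 * real d * ((1 - 1 / 2 ^ B) / R ^ (b + 1)) - C / R ^ (b + 1)"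
        using R False by (simp add: barrier_def pos_norm_sq_def max_def field_simps flip: r_def R_def)
      also have "\<dots> \<le> 2 * real d * (1 / R ^ b - 1 / (R + 1) ^ b) - C / R ^ (b + 1)"
        using drop by (intro diff_mono mult_left_mono) auto
      also have "\<dots> = (\<Sum>j<d. 2 / R ^ b - (2 / (R + 1) ^ b + C * real_of_int ((n j)\<^sup>2) / R ^ (b + 2)))"
        unfolding sum_subtractf sum.distrib sumC by (simp add: right_diff_distrib mult.commute)
      also have "\<dots> \<le> disc_laplacian d (\<lambda>n. barrier B b (norm_sq d n)) n"
        unfolding lap
      proof (intro sum_mono diff_mono)
        fix j assume "j \<in> {..<d}"
        then show "barrier B b (r + 1 - 2 * n j) + barrier B b (r + 1 + 2 * n j)
            \<le> 2 / (R + 1) ^ b + C * real_of_int ((n j)\<^sup>2) / R ^ (b + 2)"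
          using pair[OF r coord[of j]] by (simp add: R_def)
      qed (use False in \<open>simp add: barrier_def R_def\<close>)
      finally show ?thesis .
    qed
  qed
  then show ?thesis using C by blast
qed

section \<open>The lower bound\<close>

text \<open>
  With the weight \<open>\<rho>\<^sup>-\<^sup>k\<close> both functions in the ground state inequality are barriers, with
  exponents \<open>B\<close> and \<open>B + k\<close>, so the same supersolution property applies to each.
\<close>

lemma weighted_hardy:
  "\<exists>C\<ge>0. \<forall>k\<le>m. \<forall>d f. finsupp f \<longrightarrow>
     (2 * real d * (1 - 1 / 2 ^ B) - C) * (\<Sum>\<^sub>\<infinity>n. (f n)\<^sup>2 / pos_norm_sq d n ^ Suc k)
       \<le> (\<Sum>\<^sub>\<infinity>n. f n * disc_laplacian d f n / pos_norm_sq d n ^ k)"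
proof -
  have "\<forall>k. \<exists>C\<ge>0. \<forall>d n. (2 * real d * (1 - 1 / 2 ^ B) - C) * (barrier B (B + k) (norm_sq d n) / pos_norm_sq d n)
     \<le> disc_laplacian d (\<lambda>n. barrier B (B + k) (norm_sq d n)) n"
    using barrier_supersolution[of B "B + k" for k] by simp
  then obtain K where K0: "\<And>k. K k \<ge> (0::real)" and K: "\<And>k d n.
      (2 * real d * (1 - 1 / 2 ^ B) - K k) * (barrier B (B + k) (norm_sq d n) / pos_norm_sq d n)
        \<le> disc_laplacian d (\<lambda>n. barrier B (B + k) (norm_sq d n)) n"
    by metis
  define C where "C = (\<Sum>k\<le>m. K k)"
  have KC: "K k \<le> C" if "k \<le> m" for k
    unfolding C_def using that K0 by (intro member_le_sum) auto
  have "(2 * real d * (1 - 1 / 2 ^ B) - C) * (\<Sum>\<^sub>\<infinity>n. (f n)\<^sup>2 / pos_norm_sq d n ^ Suc k)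
       \<le> (\<Sum>\<^sub>\<infinity>n. f n * disc_laplacian d f n / pos_norm_sq d n ^ k)"
    if k: "k \<le> m" and f: "finsupp f" for k d f
  proof -
    define c where "c = 2 * real d * (1 - 1 / 2 ^ B) - C"
    define \<phi> where "\<phi> l n = barrier B (B + l) (norm_sq d n)" for l n
    define V where "V n = 1 / pos_norm_sq d n ^ k" for n
    have pos: "\<phi> l n > 0" for l n
      by (simp add: \<phi>_def barrier_norm_sq_pos)
    have super: "c * (\<phi> l n / pos_norm_sq d n) \<le> disc_laplacian d (\<phi> l) n" if "l \<le> m" for l n
    proof -
      have "c * (\<phi> l n / pos_norm_sq d n)
          \<le> (2 * real d * (1 - 1 / 2 ^ B) - K l) * (\<phi> l n / pos_norm_sq d n)"
        using KC[OF that] pos[of l n] less_imp_le[OF pos_norm_sq_pos]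
        by (intro mult_right_mono divide_nonneg_nonneg) (auto simp: c_def less_imp_le)
      also have "\<dots> \<le> disc_laplacian d (\<phi> l) n"
        unfolding \<phi>_def by (rule K)
      finally show ?thesis .
    qed
    have V\<phi>: "(\<lambda>n. V n * \<phi> 0 n) = \<phi> k"
    proof
      fix n
      show "V n * \<phi> 0 n = \<phi> k n"
        using norm_sq_nonneg[of d n]
        by (auto simp: V_def \<phi>_def barrier_def pos_norm_sq_def power_add max_def)
    qed
    have point: "c * ((f n)\<^sup>2 / pos_norm_sq d n ^ Suc k)
        \<le> ((V n * disc_laplacian d (\<phi> 0) n + disc_laplacian d (\<lambda>n. V n * \<phi> 0 n) n) / (2 * \<phi> 0 n)) * (f n)\<^sup>2" for n
    proof -
      have V0: "V n \<ge> 0"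
        by (simp add: V_def less_imp_le)
      have "c * (V n / pos_norm_sq d n) * (2 * \<phi> 0 n)
          = V n * (c * (\<phi> 0 n / pos_norm_sq d n)) + c * ((V n * \<phi> 0 n) / pos_norm_sq d n)"
        by (simp add: field_simps)
      also have "\<dots> \<le> V n * disc_laplacian d (\<phi> 0) n + disc_laplacian d (\<phi> k) n"
        using super[of 0 n] super[OF k, of n] V0 fun_cong[OF V\<phi>, of n]
        by (intro add_mono mult_left_mono) auto
      finally have "c * (V n / pos_norm_sq d n)
          \<le> (V n * disc_laplacian d (\<phi> 0) n + disc_laplacian d (\<phi> k) n) / (2 * \<phi> 0 n)"
        using pos[of 0 n] by (simp add: le_divide_eq)
      then have "c * (V n / pos_norm_sq d n) * (f n)\<^sup>2
          \<le> ((V n * disc_laplacian d (\<phi> 0) n + disc_laplacian d (\<phi> k) n) / (2 * \<phi> 0 n)) * (f n)\<^sup>2"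
        by (rule mult_right_mono) simp
      moreover have "c * (V n / pos_norm_sq d n) * (f n)\<^sup>2 = c * ((f n)\<^sup>2 / pos_norm_sq d n ^ Suc k)"
        by (simp add: V_def)
      ultimately show ?thesis
        unfolding V\<phi> by simp
    qed
    have fin: "finsupp (\<lambda>n. c * ((f n)\<^sup>2 / pos_norm_sq d n ^ Suc k))"
      unfolding divide_inverse by (intro finsupp_mult disjI2 disjI1 finsupp_power2 f)
    have "c * (\<Sum>\<^sub>\<infinity>n. (f n)\<^sup>2 / pos_norm_sq d n ^ Suc k) = (\<Sum>\<^sub>\<infinity>n. c * ((f n)\<^sup>2 / pos_norm_sq d n ^ Suc k))"
      by (rule infsum_cmult_right'[symmetric])
    also have "\<dots> \<le> (\<Sum>\<^sub>\<infinity>n. ((V n * disc_laplacian d (\<phi> 0) n + disc_laplacian d (\<lambda>n. V n * \<phi> 0 n) n) / (2 * \<phi> 0 n)) * (f n)\<^sup>2)"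
      by (intro infsum_mono_finsupp point fin finsupp_mult disjI2 finsupp_power2 f)
    also have "\<dots> \<le> (\<Sum>\<^sub>\<infinity>n. V n * f n * disc_laplacian d f n)"
      by (intro ground_state_inequality f pos) (simp add: V_def less_imp_le)
    also have "\<dots> = (\<Sum>\<^sub>\<infinity>n. f n * disc_laplacian d f n / pos_norm_sq d n ^ k)"
      by (simp add: V_def)
    finally show ?thesis
      by (simp only: c_def)
  qed
  moreover have "C \<ge> 0"
    unfolding C_def by (intro sum_nonneg K0)
  ultimately show ?thesis
    by blast
qed

text \<open>
  A weighted Hardy inequality gives the weighted Rellich inequality by completing the square
  \<open>(\<Delta>f - c f / \<rho>)\<^sup>2 \<ge> 0\<close>, with no loss in the constant.
\<close>

lemma rellich_from_hardy:
  assumes f: "finsupp f" and c: "c \<ge> 0"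
    and hardy: "c * (\<Sum>\<^sub>\<infinity>n. (f n)\<^sup>2 / pos_norm_sq d n ^ (k + 2))
      \<le> (\<Sum>\<^sub>\<infinity>n. f n * disc_laplacian d f n / pos_norm_sq d n ^ (k + 1))"
  shows "c\<^sup>2 * (\<Sum>\<^sub>\<infinity>n. (f n)\<^sup>2 / pos_norm_sq d n ^ (k + 2))
      \<le> (\<Sum>\<^sub>\<infinity>n. (disc_laplacian d f n)\<^sup>2 / pos_norm_sq d n ^ k)"
proof -
  define L where "L = disc_laplacian d f"
  define \<rho> where "\<rho> = pos_norm_sq d"
  define S where "S = (\<Sum>\<^sub>\<infinity>n. (f n)\<^sup>2 / \<rho> n ^ (k + 2))"
  define T where "T = (\<Sum>\<^sub>\<infinity>n. f n * L n / \<rho> n ^ (k + 1))"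
  have finL: "finsupp L" using f by (simp add: L_def)
  have fin: "finsupp (\<lambda>n. (f n)\<^sup>2 / \<rho> n ^ (k + 2))" "finsupp (\<lambda>n. f n * L n / \<rho> n ^ (k + 1))"
    "finsupp (\<lambda>n. (L n)\<^sup>2 / \<rho> n ^ k)"
    unfolding divide_inverse by (intro finsupp_mult disjI1 finsupp_power2 f finL)+
  have "c\<^sup>2 * S = 2 * c * (c * S) - c\<^sup>2 * S"
    by (simp add: power2_eq_square)
  also have "\<dots> \<le> 2 * c * T - c\<^sup>2 * S"
    using hardy c unfolding S_def T_def L_def \<rho>_def by (intro diff_right_mono mult_left_mono) auto
  also have "\<dots> = (\<Sum>\<^sub>\<infinity>n. 2 * c * (f n * L n / \<rho> n ^ (k + 1)) - c\<^sup>2 * ((f n)\<^sup>2 / \<rho> n ^ (k + 2)))"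
    unfolding S_def T_def infsum_cmult_right'[symmetric]
    by (intro infsum_diff_finsupp[symmetric] finsupp_mult disjI2 fin)
  also have "\<dots> \<le> (\<Sum>\<^sub>\<infinity>n. (L n)\<^sup>2 / \<rho> n ^ k)"
  proof (intro infsum_mono_finsupp finsupp_diff finsupp_mult disjI2 fin)
    fix n
    have r: "\<rho> n > 0" by (simp add: \<rho>_def)
    then have "0 \<le> (L n - c * f n / \<rho> n)\<^sup>2 / \<rho> n ^ k"
      by (intro divide_nonneg_pos) auto
    also have "\<dots> = (L n)\<^sup>2 / \<rho> n ^ k - (2 * c * (f n * L n / \<rho> n ^ (k + 1)) - c\<^sup>2 * ((f n)\<^sup>2 / \<rho> n ^ (k + 2)))"
      using r by (simp add: field_simps power2_eq_square)
    finally show "2 * c * (f n * L n / \<rho> n ^ (k + 1)) - c\<^sup>2 * ((f n)\<^sup>2 / \<rho> n ^ (k + 2)) \<le> (L n)\<^sup>2 / \<rho> n ^ k"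
      by (simp only: diff_ge_0_iff_ge)
  qed
  finally show ?thesis
    by (simp only: S_def L_def \<rho>_def)
qed

text \<open>
  Each Laplacian is traded for a factor \<open>c\<^sup>2\<close> and two powers of the weight; for odd order the gradient
  is traded first, by the unweighted Hardy inequality.
\<close>

lemma energy_lower_bound:
  "\<exists>C\<ge>0. \<forall>d u. finsupp u \<longrightarrow> 2 * real d * (1 - 1 / 2 ^ B) - C \<ge> 0 \<longrightarrow>
     (2 * real d * (1 - 1 / 2 ^ B) - C) ^ m * (\<Sum>\<^sub>\<infinity>n. (u n)\<^sup>2 / pos_norm_sq d n ^ m)
       \<le> (\<Sum>\<^sub>\<infinity>n. (norm_D d m u n)\<^sup>2)"
proof -
  obtain C where C: "C \<ge> 0" and hardy: "\<And>k d f. k \<le> m \<Longrightarrow> finsupp f \<Longrightarrow>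
     (2 * real d * (1 - 1 / 2 ^ B) - C) * (\<Sum>\<^sub>\<infinity>n. (f n)\<^sup>2 / pos_norm_sq d n ^ Suc k)
       \<le> (\<Sum>\<^sub>\<infinity>n. f n * disc_laplacian d f n / pos_norm_sq d n ^ k)"
    using weighted_hardy[of m B] by blast
  have "c ^ m * (\<Sum>\<^sub>\<infinity>n. (u n)\<^sup>2 / pos_norm_sq d n ^ m) \<le> (\<Sum>\<^sub>\<infinity>n. (norm_D d m u n)\<^sup>2)"
    if u: "finsupp u" and c: "c = 2 * real d * (1 - 1 / 2 ^ B) - C" "c \<ge> 0" for d u c
  proof -
    let ?L = "\<lambda>k. (disc_laplacian d ^^ k) u"
    have iterate: "c ^ (2 * k) * (\<Sum>\<^sub>\<infinity>n. (u n)\<^sup>2 / pos_norm_sq d n ^ (a + 2 * k))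
        \<le> (\<Sum>\<^sub>\<infinity>n. (?L k n)\<^sup>2 / pos_norm_sq d n ^ a)" if "a + 2 * k \<le> m" for a k
      using that
    proof (induction k arbitrary: a)
      case (Suc k)
      have "c ^ (2 * Suc k) * (\<Sum>\<^sub>\<infinity>n. (u n)\<^sup>2 / pos_norm_sq d n ^ (a + 2 * Suc k))
          = c\<^sup>2 * (c ^ (2 * k) * (\<Sum>\<^sub>\<infinity>n. (u n)\<^sup>2 / pos_norm_sq d n ^ (a + 2 + 2 * k)))"
        by (simp add: power2_eq_square)
      also have "\<dots> \<le> c\<^sup>2 * (\<Sum>\<^sub>\<infinity>n. (?L k n)\<^sup>2 / pos_norm_sq d n ^ (a + 2))"
        using Suc.prems by (intro mult_left_mono Suc.IH) auto
      also have "\<dots> \<le> (\<Sum>\<^sub>\<infinity>n. (disc_laplacian d (?L k) n)\<^sup>2 / pos_norm_sq d n ^ a)"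
        using hardy[of "a + 1" "?L k" d] Suc.prems u c
        by (intro rellich_from_hardy) simp_all
      finally show ?case by simp
    qed simp
    show ?thesis
    proof (cases "even m")
      case True
      then have "m = 2 * (m div 2)" by simp
      then show ?thesis
        using iterate[of 0 "m div 2"] True by (simp add: norm_D_def)
    next
      case False
      define k where "k = (m - 1) div 2"
      have m: "m = 1 + 2 * k" using False by (simp add: k_def)
      have "c ^ m * (\<Sum>\<^sub>\<infinity>n. (u n)\<^sup>2 / pos_norm_sq d n ^ m)
          = c * (c ^ (2 * k) * (\<Sum>\<^sub>\<infinity>n. (u n)\<^sup>2 / pos_norm_sq d n ^ (1 + 2 * k)))"
        by (simp add: m)
      also have "\<dots> \<le> c * (\<Sum>\<^sub>\<infinity>n. (?L k n)\<^sup>2 / pos_norm_sq d n ^ 1)"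
        using c by (intro mult_left_mono iterate) (simp_all add: m)
      also have "\<dots> \<le> (\<Sum>\<^sub>\<infinity>n. ?L k n * disc_laplacian d (?L k) n)"
        using hardy[of 0 "?L k" d] u c by simp
      also have "\<dots> = (\<Sum>\<^sub>\<infinity>n. (norm_D d m u n)\<^sup>2)"
        using infsum_grad_sq[of "?L k" d] u False by (simp add: norm_D_def k_def)
      finally show ?thesis .
    qed
  qed
  then show ?thesis using C by blast
qed

section \<open>The upper bound\<close>

lemma infsum_abs_laplacian_le:
  assumes g: "finsupp g"
  shows "(\<Sum>\<^sub>\<infinity>n. \<bar>disc_laplacian d g n\<bar>) \<le> 4 * real d * (\<Sum>\<^sub>\<infinity>n. \<bar>g n\<bar>)"
proof -
  note fs = finsupp_abs[OF g] finsupp_abs[OF finsupp_shift[OF g]] finsupp_abs[OF finsupp_shift_minus[OF g]]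
  define G where "G j n = 2 * \<bar>g n\<bar> + \<bar>g (n - basis_pt j)\<bar> + \<bar>g (n + basis_pt j)\<bar>" for j n
  have fin: "finsupp (G j)" for j
    unfolding G_def by (intro finsupp_add finsupp_mult disjI2 fs)
  have G: "(\<Sum>\<^sub>\<infinity>n. G j n) = 4 * (\<Sum>\<^sub>\<infinity>n. \<bar>g n\<bar>)" for j
  proof -
    have "(\<Sum>\<^sub>\<infinity>n. G j n) = (\<Sum>\<^sub>\<infinity>n. 2 * \<bar>g n\<bar>) + (\<Sum>\<^sub>\<infinity>n. \<bar>g (n - basis_pt j)\<bar>) + (\<Sum>\<^sub>\<infinity>n. \<bar>g (n + basis_pt j)\<bar>)"
      unfolding G_def by (simp add: infsum_add_finsupp fs)
    then show ?thesis
      using infsum_shift[of "\<lambda>n. \<bar>g n\<bar>" "basis_pt j"] infsum_shift_minus[of "\<lambda>n. \<bar>g n\<bar>" "basis_pt j"]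
      by (simp add: infsum_cmult_right')
  qed
  have "(\<Sum>\<^sub>\<infinity>n. \<bar>disc_laplacian d g n\<bar>) \<le> (\<Sum>\<^sub>\<infinity>n. \<Sum>j<d. G j n)"
  proof (intro infsum_mono_finsupp)
    fix n
    show "\<bar>disc_laplacian d g n\<bar> \<le> (\<Sum>j<d. G j n)"
      unfolding disc_laplacian_def G_def
      by (intro order_trans[OF sum_abs] sum_mono) linarith
  qed (intro finsupp_abs finsupp_laplacian g finsupp_sum fin)+
  also have "\<dots> = 4 * real d * (\<Sum>\<^sub>\<infinity>n. \<bar>g n\<bar>)"
    by (simp add: infsum_sum_finsupp fin G)
  finally show ?thesis .
qed

lemma basis_pt_inj: "inj basis_pt"
  by (rule injI) (metis basis_pt_def zero_neq_one)

text \<open>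
  The neighbours of a point are distinct, so their contribution is controlled by the \<open>\<ell>\<^sup>1\<close> norm
  and carries no factor \<open>d\<close>.
\<close>

lemma laplacian_le_diagonal:
  assumes g: "finsupp g"
  shows "disc_laplacian d g n \<le> 2 * real d * g n + 2 * (\<Sum>\<^sub>\<infinity>n. \<bar>g n\<bar>)"
proof -
  have part: "- (\<Sum>j<d. g (h j)) \<le> (\<Sum>\<^sub>\<infinity>n. \<bar>g n\<bar>)" if "inj h" for h :: "nat \<Rightarrow> _"
  proof -
    have "- (\<Sum>j<d. g (h j)) \<le> (\<Sum>j<d. \<bar>g (h j)\<bar>)"
      unfolding sum_negf[symmetric] by (intro sum_mono) simp
    also have "\<dots> = (\<Sum>n\<in>h ` {..<d}. \<bar>g n\<bar>)"
      using that by (simp add: sum.reindex inj_on_subset)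
    also have "\<dots> \<le> (\<Sum>\<^sub>\<infinity>n. \<bar>g n\<bar>)"
      using finsupp_summable[OF finsupp_abs[OF g]] by (intro finite_sum_le_infsum) auto
    finally show ?thesis .
  qed
  have "inj (\<lambda>j. n - basis_pt j)" "inj (\<lambda>j. n + basis_pt j)"
    using basis_pt_inj by (auto simp: inj_def)
  from this[THEN part] show ?thesis
    by (simp add: disc_laplacian_def sum_subtractf)
qed

text \<open>
  In each application of \<open>\<Delta>\<close> the diagonal contributes a factor \<open>2 d\<close>, and the return from the
  neighbours is bounded by the \<open>\<ell>\<^sup>1\<close> norm of the previous iterate, which is one power of \<open>d\<close>
  smaller.
\<close>

lemma laplacian_power_unit_mass:
  fixes e :: "nat \<Rightarrow> int"
  defines "u \<equiv> (\<lambda>n. if n = e then 1 else 0 :: real)"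
  shows "(disc_laplacian d ^^ m) u e \<le> (2 * real d) ^ m + 2 * real m * (4 * real d) ^ (m - 1)"
proof -
  let ?L = "\<lambda>k. (disc_laplacian d ^^ k) u"
  have u: "finsupp u" by (simp add: finsupp_def u_def)
  have l1: "(\<Sum>\<^sub>\<infinity>n. \<bar>?L k n\<bar>) \<le> (4 * real d) ^ k" for k
  proof (induction k)
    case 0
    have "(\<Sum>\<^sub>\<infinity>n. \<bar>u n\<bar>) = (\<Sum>\<^sub>\<infinity>n\<in>{e}. \<bar>u n\<bar>)"
      by (intro infsum_cong_neutral) (auto simp: u_def)
    then show ?case by (simp add: u_def)
  next
    case (Suc k)
    have "(\<Sum>\<^sub>\<infinity>n. \<bar>?L (Suc k) n\<bar>) \<le> 4 * real d * (\<Sum>\<^sub>\<infinity>n. \<bar>?L k n\<bar>)"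
      using infsum_abs_laplacian_le[of "?L k" d] u by simp
    also have "\<dots> \<le> 4 * real d * (4 * real d) ^ k"
      by (intro mult_left_mono Suc.IH) simp
    finally show ?case by simp
  qed
  show ?thesis
  proof (induction m)
    case (Suc m)
    have absorb: "2 * real d * (2 * real m * (4 * real d) ^ (m - 1)) \<le> 2 * real m * (4 * real d) ^ m"
      by (cases m) (auto intro!: mult_right_mono)
    have "?L (Suc m) e \<le> 2 * real d * ?L m e + 2 * (\<Sum>\<^sub>\<infinity>n. \<bar>?L m n\<bar>)"
      using laplacian_le_diagonal[of "?L m" d e] u by simp
    also have "\<dots> \<le> 2 * real d * ((2 * real d) ^ m + 2 * real m * (4 * real d) ^ (m - 1)) + 2 * (4 * real d) ^ m"
      using l1[of m] by (intro add_mono mult_left_mono Suc.IH) auto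
    also have "\<dots> \<le> (2 * real d) ^ Suc m + 2 * real m * (4 * real d) ^ m + 2 * (4 * real d) ^ m"
      using absorb by (simp add: distrib_left)
    also have "\<dots> = (2 * real d) ^ Suc m + 2 * real (Suc m) * (4 * real d) ^ (Suc m - 1)"
      by (simp add: algebra_simps)
    finally show ?case .
  qed (simp add: u_def)
qed

section \<open>The asymptotics of the best constant\<close>

lemma laplacian_power_vanishes_off_lattice:
  assumes "\<And>n. n \<notin> lattice_pts d \<Longrightarrow> u n = 0" and "n \<notin> lattice_pts d"
  shows "(disc_laplacian d ^^ k) u n = 0"
  using assms(2)
proof (induction k arbitrary: n)
  case (Suc k)
  have "n - basis_pt j \<notin> lattice_pts d" "n + basis_pt j \<notin> lattice_pts d" if "j < d" for j
    using Suc.prems that by (auto simp: lattice_pts_def basis_pt_def)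
  then have "(disc_laplacian d ^^ k) u (n - basis_pt j) = 0" "(disc_laplacian d ^^ k) u (n + basis_pt j) = 0"
    if "j < d" for j
    using that by (blast intro: Suc.IH)+
  then show ?case
    using Suc.IH[OF Suc.prems] by (simp add: disc_laplacian_def[of d "(disc_laplacian d ^^ k) u"])
qed (use assms(1) in simp)

lemma infsum_norm_D_lattice:
  assumes u: "u \<in> test_functions d"
  shows "(\<Sum>\<^sub>\<infinity>n\<in>lattice_pts d. (norm_D d m u n)\<^sup>2) = (\<Sum>\<^sub>\<infinity>n. (norm_D d m u n)\<^sup>2)"
proof (rule infsum_cong_neutral)
  fix n assume n: "n \<in> UNIV - lattice_pts d"
  have off: "(disc_laplacian d ^^ k) u n = 0" if "n \<notin> lattice_pts d" for k n
    using u that by (intro laplacian_power_vanishes_off_lattice) (auto simp: test_functions_def)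
  have "n - basis_pt j \<notin> lattice_pts d" if "j < d" for j
    using n that by (auto simp: lattice_pts_def basis_pt_def)
  then show "(norm_D d m u n)\<^sup>2 = 0"
    using n off by (simp add: norm_D_def disc_grad_def L2_set_def)
qed auto

lemma infsum_hardy_weight_lattice:
  assumes u: "u \<in> test_functions d"
  shows "(\<Sum>\<^sub>\<infinity>n\<in>lattice_pts d - {0}. \<bar>u n\<bar>\<^sup>2 / lattice_norm d n ^ (2 * m))
    = (\<Sum>\<^sub>\<infinity>n. (u n)\<^sup>2 / pos_norm_sq d n ^ m)"
proof (rule infsum_cong_neutral)
  fix n assume "n \<in> (lattice_pts d - {0}) \<inter> UNIV"
  then have n: "n \<in> lattice_pts d" "n \<noteq> 0" by auto
  then obtain i where i: "n i \<noteq> 0" by (auto simp: fun_eq_iff)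
  with n have "i < d" by (auto simp: lattice_pts_def not_less[symmetric])
  then have "(n i)\<^sup>2 \<le> norm_sq d n"
    unfolding norm_sq_def by (intro member_le_sum) auto
  moreover have "(n i)\<^sup>2 > 0" using i by simp
  ultimately have "norm_sq d n \<ge> 1" by linarith
  then have "pos_norm_sq d n = of_int (norm_sq d n)" by (simp add: pos_norm_sq_def)
  also have "\<dots> = (lattice_norm d n)\<^sup>2"
    by (simp add: norm_sq_def lattice_norm_def L2_set_def sum_nonneg)
  finally show "\<bar>u n\<bar>\<^sup>2 / lattice_norm d n ^ (2 * m) = (u n)\<^sup>2 / pos_norm_sq d n ^ m"
    by (simp add: power_mult)
qed (use u in \<open>auto simp: test_functions_def\<close>)

lemma rellich_hardy_ineq_iff:
  "rellich_hardy_ineq m d C \<longleftrightarrow> (\<forall>u\<in>test_functions d.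
     C * (\<Sum>\<^sub>\<infinity>n. (u n)\<^sup>2 / pos_norm_sq d n ^ m) \<le> (\<Sum>\<^sub>\<infinity>n. (norm_D d m u n)\<^sup>2))"
  unfolding rellich_hardy_ineq_def
  by (intro ball_cong refl) (simp only: infsum_norm_D_lattice infsum_hardy_weight_lattice)

lemma best_constant_upper:
  assumes "d \<ge> 1"
  shows "best_constant m d \<le> (2 * real d) ^ m + 2 * real m * (4 * real d) ^ (m - 1)"
proof -
  define e where "e = basis_pt 0"
  define u :: "(nat \<Rightarrow> int) \<Rightarrow> real" where "u = (\<lambda>n. if n = e then 1 else 0)"
  have "e \<in> lattice_pts d" "e \<noteq> 0"
    using assms by (auto simp: e_def basis_pt_def lattice_pts_def fun_eq_iff)
  then have test: "u \<in> test_functions d"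
    by (auto simp: test_functions_def u_def)
  have fin: "finsupp u" by (simp add: finsupp_def u_def)
  have "(\<Sum>i<d. (e i)\<^sup>2) = (\<Sum>i<d. if i = 0 then 1 else 0)"
    by (intro sum.cong) (auto simp: e_def basis_pt_def)
  then have "norm_sq d e = 1"
    using assms by (simp add: norm_sq_def)
  then have e1: "pos_norm_sq d e = 1"
    by (simp add: pos_norm_sq_def)
  have at_e: "(\<Sum>\<^sub>\<infinity>n. F n) = F e" if "\<And>n. n \<noteq> e \<Longrightarrow> F n = 0" for F :: "(nat \<Rightarrow> int) \<Rightarrow> real"
  proof -
    have "(\<Sum>\<^sub>\<infinity>n. F n) = (\<Sum>\<^sub>\<infinity>n\<in>{e}. F n)"
      using that by (intro infsum_cong_neutral) auto
    then show ?thesis by simp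
  qed
  have "best_constant m d * (\<Sum>\<^sub>\<infinity>n. (u n)\<^sup>2 / pos_norm_sq d n ^ m) \<le> (\<Sum>\<^sub>\<infinity>n. (norm_D d m u n)\<^sup>2)"
    using best_constant_greatest(1)[OF assms, of m] test by (simp add: rellich_hardy_ineq_iff)
  also have "(\<Sum>\<^sub>\<infinity>n. (u n)\<^sup>2 / pos_norm_sq d n ^ m) = 1"
    by (subst at_e) (simp_all add: u_def e1)
  also have "(\<Sum>\<^sub>\<infinity>n. (norm_D d m u n)\<^sup>2) = (\<Sum>\<^sub>\<infinity>n. u n * (disc_laplacian d ^^ m) u n)"
    by (rule energy_eq_laplacian_power[OF fin])
  also have "\<dots> = (disc_laplacian d ^^ m) u e"
    by (subst at_e) (simp_all add: u_def)
  also have "\<dots> \<le> (2 * real d) ^ m + 2 * real m * (4 * real d) ^ (m - 1)"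
    unfolding u_def by (rule laplacian_power_unit_mass)
  finally show ?thesis by simp
qed

lemma best_constant_lower:
  "\<exists>C\<ge>0. \<forall>d\<ge>1. 2 * real d * (1 - 1 / 2 ^ B) - C \<ge> 0 \<longrightarrow>
     (2 * real d * (1 - 1 / 2 ^ B) - C) ^ m \<le> best_constant m d"
proof -
  obtain C where C: "C \<ge> 0" and bound: "\<And>d u. finsupp u \<Longrightarrow> 2 * real d * (1 - 1 / 2 ^ B) - C \<ge> 0 \<Longrightarrow>
     (2 * real d * (1 - 1 / 2 ^ B) - C) ^ m * (\<Sum>\<^sub>\<infinity>n. (u n)\<^sup>2 / pos_norm_sq d n ^ m)
       \<le> (\<Sum>\<^sub>\<infinity>n. (norm_D d m u n)\<^sup>2)"
    using energy_lower_bound[of B m] by blast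
  have "(2 * real d * (1 - 1 / 2 ^ B) - C) ^ m \<le> best_constant m d"
    if "d \<ge> 1" "2 * real d * (1 - 1 / 2 ^ B) - C \<ge> 0" for d
    using that bound
    by (intro best_constant_greatest(2)) (auto simp: rellich_hardy_ineq_iff test_functions_def finsupp_def)
  then show ?thesis using C by blast
qed

theorem theorem1p1:
  fixes m :: nat
  assumes "m \<ge> 1"
  shows "(\<lambda>d::nat. best_constant m d / real d ^ m) \<longlonglongrightarrow> 2 ^ m"
proof (rule order_tendstoI)
  fix a :: real assume a: "a < 2 ^ m"
  \<comment> \<open>First fix the height \<open>2\<^sup>B\<close> of the barrier, then let the dimension grow.\<close>
  have "(\<lambda>B. (2 * (1 - (1 / 2 :: real) ^ B)) ^ m) \<longlonglongrightarrow> (2 * (1 - 0)) ^ m"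
    by (intro tendsto_intros LIMSEQ_power_zero) auto
  then have "eventually (\<lambda>B. a < (2 * (1 - (1 / 2) ^ B)) ^ m \<and> B \<ge> 1) sequentially"
    using a by (intro eventually_conj order_tendstoD(1)[of _ "2 ^ m"] eventually_ge_at_top) simp_all
  then obtain B where B: "a < (2 * (1 - (1 / 2 :: real) ^ B)) ^ m" "B \<ge> 1"
    by (auto dest!: eventually_happens)
  define \<kappa> :: real where "\<kappa> = 2 * (1 - (1 / 2) ^ B)"
  obtain C where C: "C \<ge> 0" and low: "\<And>d. d \<ge> 1 \<Longrightarrow> \<kappa> * real d - C \<ge> 0 \<Longrightarrow>
      (\<kappa> * real d - C) ^ m \<le> best_constant m d"
    using best_constant_lower[of B m] by (auto simp: \<kappa>_def power_one_over algebra_simps)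
  have "(1 / 2 :: real) ^ B \<le> (1 / 2) ^ 1"
    using B by (intro power_decreasing) auto
  then have \<kappa>: "\<kappa> \<ge> 1" by (simp add: \<kappa>_def)
  have lim: "(\<lambda>d. (\<kappa> - C / real d) ^ m) \<longlonglongrightarrow> (\<kappa> - 0) ^ m"
    by (intro tendsto_intros lim_const_over_n)
  then have ev: "eventually (\<lambda>d. a < (\<kappa> - C / real d) ^ m) sequentially"
    using B by (intro order_tendstoD(1)[OF lim]) (simp add: \<kappa>_def)
  have "eventually (\<lambda>d::nat. d \<ge> max 1 (nat \<lceil>C\<rceil>)) sequentially"
    by (rule eventually_ge_at_top)
  with ev show "eventually (\<lambda>d. a < best_constant m d / real d ^ m) sequentially"
  proof eventually_elim
    case (elim d)
    then have d: "d \<ge> 1" "real d \<ge> C" by linarith+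
    have "C \<le> \<kappa> * real d"
      using d \<kappa> mult_right_mono[of 1 \<kappa> "real d"] by (simp add: order_trans)
    then have "(\<kappa> * real d - C) ^ m \<le> best_constant m d"
      using d by (intro low) auto
    moreover have "\<kappa> * real d - C = (\<kappa> - C / real d) * real d"
      using d by (simp add: field_simps)
    ultimately have "(\<kappa> - C / real d) ^ m \<le> best_constant m d / real d ^ m"
      using d by (simp add: le_divide_eq power_mult_distrib)
    with elim show ?case by simp
  qed
next
  fix a :: real assume a: "2 ^ m < a"
  have lim: "(\<lambda>d. 2 ^ m + (2 * real m * 4 ^ (m - 1)) / real d) \<longlonglongrightarrow> 2 ^ m + 0"
    by (intro tendsto_intros lim_const_over_n)
  then have ev: "eventually (\<lambda>d. 2 ^ m + (2 * real m * 4 ^ (m - 1)) / real d < a) sequentially"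
    using a by (intro order_tendstoD(2)[OF lim]) simp
  have "eventually (\<lambda>d::nat. d \<ge> 1) sequentially"
    by (rule eventually_ge_at_top)
  with ev show "eventually (\<lambda>d. best_constant m d / real d ^ m < a) sequentially"
  proof eventually_elim
    case (elim d)
    have dm: "real d ^ m = real d * real d ^ (m - 1)"
      using assms by (simp add: power_eq_if)
    have "best_constant m d / real d ^ m
        \<le> ((2 * real d) ^ m + 2 * real m * (4 * real d) ^ (m - 1)) / real d ^ m"
      using elim by (intro divide_right_mono best_constant_upper) auto
    also have "\<dots> = (2 * real d) ^ m / real d ^ m + 2 * real m * (4 * real d) ^ (m - 1) / (real d * real d ^ (m - 1))"
      by (simp only: add_divide_distrib dm[symmetric])
    also have "\<dots> = 2 ^ m + (2 * real m * 4 ^ (m - 1)) / real d"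
      using elim by (simp add: power_mult_distrib)
    finally show ?case using elim by simp
  qed
qed

end
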